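(* Let $k\ge 1$, let $H$ be a set of $k$ closed halfspaces in $\mathbb{R}^d$, and let $\mathcal{B}_1,\dots,\mathcal{B}_k$ be nonempty finite families of $H$-convex sets in $\mathbb{R}^d$ (not necessarily distinct or disjoint). Then there is a selection $B_i\in\mathcal{B}_i$ for each $i\in\{1,\dots,k\}$ and an index $\ell\in\{1,\dots,k\}$ such that $\bigcap_{i=1}^{k}B_i\subseteq\bigcap\mathcal{B}_\ell$.
   Context: Let $H=\{H_1,\dots,H_k\}$ be a set of $k$ closed halfspaces in $\mathbb{R}^d$. An $H$-convex set $B$ in $\mathbb{R}^d$ is an intersection of $k$ halfspaces $H_1^B,\dots,H_k^B$ such that for each $i$ the halfspace $H_i^B$ is a translate of $H_i$. For a family $\mathcal{B}$, $\bigcap\mathcal{B}$ denotes the intersection of all its members. *)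

theory Defs
  imports "HOL-Analysis.Analysis"
begin

definition closed_halfspace :: "'a::euclidean_space set \<Rightarrow> bool" where
  "closed_halfspace S \<longleftrightarrow> (\<exists>a b. a \<noteq> 0 \<and> S = {x. a \<bullet> x \<le> b})"

definition translate_of :: "'a::euclidean_space set \<Rightarrow> 'a set \<Rightarrow> bool" where
  "translate_of T S \<longleftrightarrow> (\<exists>v. T = (\<lambda>x. v + x) ` S)"

text \<open>The translated halfspaces are indexed by the members of \<open>H\<close> themselves: \<open>T h\<close> is the
  translate of \<open>h\<close>. The resulting intersection may be empty.\<close>

definition H_convex :: "'a::euclidean_space set set \<Rightarrow> 'a set \<Rightarrow> bool" where
  "H_convex H B \<longleftrightarrow> (\<exists>T. (\<forall>h\<in>H. translate_of (T h) h) \<and> B = (\<Inter>h\<in>H. T h))"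

end

theory Submission
  imports Defs
begin

text \<open>
  Translates of one halfspace differ only in their offset, so they are linearly ordered by
  inclusion, and an \<open>H\<close>-convex set amounts to one offset for each direction \<open>h \<in> H\<close>. A greedy
  selection then works. Treat the directions one after the other. For direction \<open>h\<close>, take a set
  whose \<open>h\<close>-offset is smallest among all members of all families that have not been used yet; it
  represents the family it comes from, and that family is now used. As there are as many families
  as directions, each direction uses exactly one family. Let \<open>\<B> l\<close> be the family used last. It was
  still available at every step, so for each \<open>h\<close> some selected set has an \<open>h\<close>-offset that is at
  most that of any member of \<open>\<B> l\<close>. Hence the intersection of the selected sets satisfies every
  inequality that defines a member of \<open>\<B> l\<close>. The lemma \<open>greedy_selection\<close> is the combinatorial
  part, for arbitrary real-valued functions in place of offsets.
\<close>

text \<open>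
  The induction removes one direction \<open>h\<close> together with the family that contains an overall
  minimizer of \<open>f h\<close>. The induction hypothesis gives an \<open>l\<close> among the other families, and over all
  of these the removed minimizer is a lower bound for \<open>f h\<close>. The index set \<open>I\<close> has to vary because
  the removed family depends on \<open>f\<close>.
\<close>

lemma greedy_selection:
  fixes f :: "'h \<Rightarrow> 'x \<Rightarrow> real"
  assumes "finite D" and "D \<noteq> {}" and "card I = card D"
    and "\<And>i. i \<in> I \<Longrightarrow> finite (F i)" and "\<And>i. i \<in> I \<Longrightarrow> F i \<noteq> {}"
  shows "\<exists>B. \<exists>l\<in>I. (\<forall>i\<in>I. B i \<in> F i) \<and> (\<forall>h\<in>D. \<exists>i\<in>I. \<forall>C\<in>F l. f h (B i) \<le> f h C)"
  using assms
proof (induction D arbitrary: I rule: finite_ne_induct)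
  case (singleton h)
  then obtain l where I: "I = {l}"
    by (auto simp: card_1_singleton_iff)
  then obtain b where "b \<in> F l" "\<forall>C\<in>F l. f h b \<le> f h C"
    using singleton ex_min_if_finite[of "f h ` F l"] by (force simp: not_less)
  then show ?case
    using I by (intro exI[of _ "\<lambda>_. b"]) auto
next
  case (insert h D)
  have "finite I" "I \<noteq> {}"
    using insert by (auto intro: card_ge_0_finite)
  then have "finite (f h ` (\<Union>i\<in>I. F i))" "f h ` (\<Union>i\<in>I. F i) \<noteq> {}"
    using insert.prems by auto
  from ex_min_if_finite[OF this] obtain j b
    where j: "j \<in> I" "b \<in> F j" and b: "\<And>i C. i \<in> I \<Longrightarrow> C \<in> F i \<Longrightarrow> f h b \<le> f h C"
    by (force simp: not_less)
  have "card (I - {j}) = card D"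
    using insert j \<open>finite I\<close> by simp
  with insert.IH[of "I - {j}"] insert.prems obtain B l
    where l: "l \<in> I - {j}" and B: "\<forall>i\<in>I - {j}. B i \<in> F i"
      and le: "\<forall>g\<in>D. \<exists>i\<in>I - {j}. \<forall>C\<in>F l. f g (B i) \<le> f g C"
    by auto
  let ?B = "B(j := b)"
  have "\<exists>i\<in>I. \<forall>C\<in>F l. f g (?B i) \<le> f g C" if "g \<in> insert h D" for g
  proof (cases "g = h")
    case True
    then show ?thesis
      using j b l by (intro bexI[of _ j]) auto
  next
    case False
    then obtain i where "i \<in> I - {j}" "\<forall>C\<in>F l. f g (B i) \<le> f g C"
      using le \<open>g \<in> insert h D\<close> by auto
    then show ?thesis
      by (intro bexI[of _ i]) auto
  qed
  moreover have "\<forall>i\<in>I. ?B i \<in> F i"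
    using B j by auto
  ultimately show ?case
    using l by (intro exI[of _ ?B] bexI[of _ l]) auto
qed

lemma translates_of_halfspace:
  assumes "closed_halfspace S"
  shows "\<exists>a. \<forall>T. translate_of T S \<longrightarrow> (\<exists>c. T = {x. a \<bullet> x \<le> c})"
proof -
  obtain a b where S: "S = {x. a \<bullet> x \<le> b}"
    using assms by (auto simp: closed_halfspace_def)
  have "\<exists>c. T = {x. a \<bullet> x \<le> c}" if "translate_of T S" for T
  proof -
    obtain v where v: "T = (\<lambda>x. v + x) ` S"
      using \<open>translate_of T S\<close> by (auto simp: translate_of_def)
    have "y \<in> T \<longleftrightarrow> a \<bullet> y \<le> b + a \<bullet> v" for y
    proof
      assume "a \<bullet> y \<le> b + a \<bullet> v"
      then show "y \<in> T"
        unfolding v S by (intro image_eqI[of _ _ "y - v"]) (auto simp: inner_diff_right)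
    qed (auto simp: v S inner_add_right)
    then show ?thesis
      by blast
  qed
  then show ?thesis
    by blast
qed

text \<open>
  The normal vector \<open>a h\<close> depends only on \<open>h\<close>; this is what makes the offsets of different
  \<open>H\<close>-convex sets comparable.
\<close>

lemma H_convex_eq_offsets:
  assumes "\<And>h. h \<in> H \<Longrightarrow> closed_halfspace h"
  shows "\<exists>a. \<forall>B. H_convex H B \<longrightarrow> (\<exists>c. B = {x. \<forall>h\<in>H. a h \<bullet> x \<le> c h})"
proof -
  have "\<forall>h\<in>H. \<exists>a. \<forall>T. translate_of T h \<longrightarrow> (\<exists>c. T = {x. a \<bullet> x \<le> c})"
    using assms translates_of_halfspace by blast
  from bchoice[OF this] obtain a where
    a: "\<forall>h\<in>H. \<forall>T. translate_of T h \<longrightarrow> (\<exists>c. T = {x. a h \<bullet> x \<le> c})" ..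
  have "\<exists>c. B = {x. \<forall>h\<in>H. a h \<bullet> x \<le> c h}" if "H_convex H B" for B
  proof -
    obtain T where T: "\<And>h. h \<in> H \<Longrightarrow> translate_of (T h) h" and B: "B = (\<Inter>h\<in>H. T h)"
      using \<open>H_convex H B\<close> by (auto simp: H_convex_def)
    have "\<forall>h\<in>H. \<exists>c. T h = {x. a h \<bullet> x \<le> c}"
      using a T by blast
    from bchoice[OF this] obtain c where "\<forall>h\<in>H. T h = {x. a h \<bullet> x \<le> c h}" ..
    then show ?thesis
      using B by auto
  qed
  then show ?thesis
    by blast
qed

theorem theorem2p1:
  fixes k :: nat
    and H :: "(real ^ 'n) set set"
    and \<B> :: "nat \<Rightarrow> (real ^ 'n) set set"
  assumes "k \<ge> 1"
    and "finite H" and "card H = k"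
    and "\<And>h. h \<in> H \<Longrightarrow> closed_halfspace h"
    and "\<And>i. i \<in> {1..k} \<Longrightarrow> finite (\<B> i)"
    and "\<And>i. i \<in> {1..k} \<Longrightarrow> \<B> i \<noteq> {}"
    and "\<And>i B. i \<in> {1..k} \<Longrightarrow> B \<in> \<B> i \<Longrightarrow> H_convex H B"
  shows "\<exists>B l. (\<forall>i\<in>{1..k}. B i \<in> \<B> i) \<and> l \<in> {1..k} \<and> (\<Inter>i\<in>{1..k}. B i) \<subseteq> \<Inter>(\<B> l)"
proof -
  obtain a where "\<forall>B. H_convex H B \<longrightarrow> (\<exists>c. B = {x. \<forall>h\<in>H. a h \<bullet> x \<le> c h})"
    using H_convex_eq_offsets[of H] assms(4) by blast
  then have "\<forall>B. \<exists>c. H_convex H B \<longrightarrow> B = {x. \<forall>h\<in>H. a h \<bullet> x \<le> c h}"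
    by blast
  from choice[OF this] obtain c
    where offsets: "\<And>B. H_convex H B \<Longrightarrow> B = {x. \<forall>h\<in>H. a h \<bullet> x \<le> c B h}"
    by blast
  have "H \<noteq> {}" "card {1..k} = card H"
    using assms(1,3) by auto
  with greedy_selection[of H "{1..k}" \<B> "\<lambda>h B. c B h"] assms(2,5,6) obtain B l
    where l: "l \<in> {1..k}" and B: "\<And>i. i \<in> {1..k} \<Longrightarrow> B i \<in> \<B> i"
      and le: "\<And>h. h \<in> H \<Longrightarrow> \<exists>i\<in>{1..k}. \<forall>C\<in>\<B> l. c (B i) h \<le> c C h"
    by blast
  have "x \<in> C" if x: "x \<in> (\<Inter>i\<in>{1..k}. B i)" and C: "C \<in> \<B> l" for x C
  proof -
    have "a h \<bullet> x \<le> c C h" if h: "h \<in> H" for h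
    proof -
      obtain i where i: "i \<in> {1..k}" and "c (B i) h \<le> c C h"
        using le[OF h] C by blast
      moreover have "x \<in> B i"
        using x i by blast
      then have "a h \<bullet> x \<le> c (B i) h"
        using offsets[of "B i"] assms(7)[OF i B[OF i]] h by blast
      ultimately show ?thesis
        by linarith
    qed
    then show ?thesis
      using offsets[of C] assms(7)[OF l C] by blast
  qed
  then show ?thesis
    using B l by blast
qed

end
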